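(* Let $G$ be a connected $\{P_6,\text{dart},K_4\}$-free graph with no clique cutset, and let $H$ be an induced diamond in $G$ with $V(H)=\{u_1,u_2,u_3,u_4\}$ and $E(H)=\{u_1u_2,u_2u_3,u_3u_4,u_4u_1,u_1u_3\}$. Let $A_2,B_{13},C_2,C_4,Z,Z_1$ and bad components be as defined in the context, and assume $C_2=C_4=\emptyset$ and $B_{13}\neq\emptyset$. Then there exist no vertices $x,y,z\in A_2$ and bad components $Q=\{q,q'\}$, $R=\{r,r'\}$ of $G[Z_1]$ such that $xy\in E(G[A_2])$, $Q$ is complete to $\{x,z\}$, and $R$ is complete to $\{z,y\}$.
   Context: All graphs are finite, simple and undirected. $P_6$ is the path on $6$ vertices. A diamond is $K_4$ minus an edge; a dart is the graph obtained from a diamond by adding a new vertex adjacent to exactly one vertex of the diamond, that vertex being one of degree $3$ in the diamond. $\{P_6,\text{dart},K_4\}$-free means having no induced subgraph isomorphic to $P_6$, the dart, or $K_4$. A clique cutset of $G$ is a clique $K\subseteq V(G)$ such that $G\setminus K$ has more components than $G$. For disjoint vertex sets $X,Y$, $X$ is complete to $Y$ if every vertex of $X$ is adjacent to every vertex of $Y$. $G[S]$ is the subgraph induced by $S$; components of $G[S]$ are identified with their vertex sets. For $x\in V(G)\setminus V(H)$ write $N_H(x)=N(x)\cap V(H)$. Define $A_2=\{x\in V(G)\setminus V(H):N_H(x)=\{u_2\}\}$, $B_{13}=\{x\in V(G)\setminus V(H):N_H(x)=\{u_1,u_3\}\}$, $C_2=\{x\in V(G)\setminus V(H):N_H(x)=\{u_2,u_3,u_4\}\}$,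 $C_4=\{x\in V(G)\setminus V(H):N_H(x)=\{u_4,u_1,u_2\}\}$, $Z=\{x\in V(G)\setminus V(H):N_H(x)=\emptyset\}$. $Z_1$ is the union of those components of $G[Z]$ that have a neighbor in $A_2$ (i.e. contain a vertex adjacent to some vertex of $A_2$). A component $Q=\{q,q'\}$ of $G[Z_1]$ (with exactly two vertices) is called bad if $qq'\in E(G)$ and both $q$ and $q'$ have a neighbor in $B_{13}$. *)

theory Defs
  imports "Graph_Theory.Graph_Theory"
begin

text \<open>A finite simple undirected graph is a \<open>Digraph.graph\<close>: a finite symmetric digraph without
  loops or parallel arcs, an edge \<open>uv\<close> being the pair of arcs \<open>(u, v)\<close>, \<open>(v, u)\<close>.
  For such graphs \<open>pre_digraph.sccs_verts\<close> is the set of vertex sets of the connected components.\<close>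

definition path_graph :: "nat \<Rightarrow> nat pair_pre_digraph" where
  "path_graph n = \<lparr>pverts = {0..<n}, parcs = symcl {(i, Suc i) | i. Suc i < n}\<rparr>"

text \<open>The vertices 1, 2, 3, 4 form the diamond, in which 1 and 3 have degree 3;
  5 is the additional vertex.\<close>

definition dart_graph :: "nat pair_pre_digraph" where
  "dart_graph = \<lparr>pverts = {1, 2, 3, 4, 5},
     parcs = symcl {(1, 2), (2, 3), (3, 4), (4, 1), (1, 3), (1, 5)}\<rparr>"

definition P6_dart_K4_free :: "('a, 'b) pre_digraph \<Rightarrow> bool" where
  "P6_dart_K4_free G \<longleftrightarrow> \<not> (\<exists>F. induced_subgraph F G \<and>
     (digraph_iso (with_proj (path_graph 6)) F \<or> digraph_iso (with_proj dart_graph) F \<or>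
      complete_digraph 4 F))"

definition is_clique :: "('a, 'b) pre_digraph \<Rightarrow> 'a set \<Rightarrow> bool" where
  "is_clique G K \<longleftrightarrow> K \<subseteq> verts G \<and> (\<forall>u\<in>K. \<forall>v\<in>K. u \<noteq> v \<longrightarrow> u \<rightarrow>\<^bsub>G\<^esub> v)"

definition clique_cutset :: "('a, 'b) pre_digraph \<Rightarrow> 'a set \<Rightarrow> bool" where
  "clique_cutset G K \<longleftrightarrow> is_clique G K \<and>
     card (pre_digraph.sccs_verts (G \<restriction> (verts G - K))) > card (pre_digraph.sccs_verts G)"

definition nbrs_in :: "('a, 'b) pre_digraph \<Rightarrow> ('a, 'b) pre_digraph \<Rightarrow> 'a \<Rightarrow> 'a set" where
  "nbrs_in G H x = {v \<in> verts H. x \<rightarrow>\<^bsub>G\<^esub> v}"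

definition attached :: "('a, 'b) pre_digraph \<Rightarrow> ('a, 'b) pre_digraph \<Rightarrow> 'a set \<Rightarrow> 'a set" where
  "attached G H T = {x \<in> verts G - verts H. nbrs_in G H x = T}"

definition has_nbr_in :: "('a, 'b) pre_digraph \<Rightarrow> 'a \<Rightarrow> 'a set \<Rightarrow> bool" where
  "has_nbr_in G v X \<longleftrightarrow> (\<exists>x\<in>X. v \<rightarrow>\<^bsub>G\<^esub> x)"

text \<open>Disjointness of \<open>X\<close> and \<open>Y\<close> is implied, since graphs have no loops.\<close>

definition complete_to :: "('a, 'b) pre_digraph \<Rightarrow> 'a set \<Rightarrow> 'a set \<Rightarrow> bool" where
  "complete_to G X Y \<longleftrightarrow> (\<forall>x\<in>X. \<forall>y\<in>Y. x \<rightarrow>\<^bsub>G\<^esub> y)"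

definition bad_component ::
    "('a, 'b) pre_digraph \<Rightarrow> 'a set \<Rightarrow> 'a set \<Rightarrow> 'a \<Rightarrow> 'a \<Rightarrow> bool" where
  "bad_component G Z1 B13 q q' \<longleftrightarrow>
     q \<noteq> q' \<and> {q, q'} \<in> pre_digraph.sccs_verts (G \<restriction> Z1) \<and>
     q \<rightarrow>\<^bsub>G\<^esub> q' \<and> has_nbr_in G q B13 \<and> has_nbr_in G q' B13"

end

theory Submission
  imports Defs
begin

text \<open>
  The argument is a finite chase through the forbidden subgraphs. The badness of the two components
  enters only through a single neighbour in \<open>B13\<close> of one of the four vertices, say of \<open>q\<close>.

  Two vertices that are both complete to the edge \<open>qq'\<close> are nonadjacent, as otherwise there is a
  \<open>K\<^sub>4\<close>; so \<open>Q \<noteq> R\<close>, for \<open>x\<close> and \<open>y\<close> are adjacent. Distinct components have no edges between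
  them. If \<open>q\<close> were adjacent to \<open>y\<close>, the diamond \<open>u2, x, q, y\<close> together with a vertex of \<open>R\<close> not
  adjacent to \<open>x\<close>, which exists by \<open>K\<^sub>4\<close>-freeness, would be a dart
  (\<open>triangle_extension_nonadjacent\<close>).

  Now take a neighbour \<open>b \<in> B13\<close> of \<open>q\<close> (\<open>no_linked_triangles\<close>). It is not adjacent to \<open>z\<close>:
  otherwise either \<open>b, z, q, q'\<close> is a \<open>K\<^sub>4\<close>, or the diamond \<open>b, q, q', z\<close> with \<open>u2\<close> attached to
  \<open>z\<close> is a dart. The \<open>P\<^sub>6\<close>-freeness applied to paths starting with \<open>u4, u1, b\<close> then spreads the
  neighbourhood of \<open>b\<close>: to all of \<open>R\<close> along \<open>q, z\<close>, and from there back to \<open>q'\<close> along \<open>r, z\<close>.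
  Hence \<open>b\<close> is complete to \<open>Q \<union> R\<close>, and so adjacent to neither \<open>x\<close> nor \<open>y\<close> by \<open>K\<^sub>4\<close>-freeness;
  but then \<open>u4, u1, b, q, x, y\<close> is an induced \<open>P\<^sub>6\<close>.
\<close>

section \<open>Excluded induced subgraphs in terms of adjacency\<close>

text \<open>In a digraph without parallel arcs, an injection of vertices that preserves and reflects
  adjacency determines the arc map of an isomorphism onto an induced subgraph.\<close>

lemma (in nomulti_digraph) digraph_iso_induce_subgraphI:
  assumes wf: "pair_wf_digraph P"
    and inj: "inj_on f (pverts P)"
    and adj: "\<And>u v. u \<in> pverts P \<Longrightarrow> v \<in> pverts P \<Longrightarrow> f u \<rightarrow>\<^bsub>G\<^esub> f v \<longleftrightarrow> (u, v) \<in> parcs P"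
  shows "digraph_iso (with_proj P) (G \<restriction> f ` pverts P)"
proof -
  interpret P: pair_wf_digraph P by (rule wf)
  \<comment> \<open>the unique arc with a given pair of ends\<close>
  define arc_at where "arc_at p = the_inv_into (arcs G) (arc_to_ends G) p" for p
  have arc_at: "arc_at (u, v) \<in> arcs G \<and> tail G (arc_at (u, v)) = u \<and> head G (arc_at (u, v)) = v"
    if "u \<rightarrow>\<^bsub>G\<^esub> v" for u v
  proof -
    have "(u, v) \<in> arc_to_ends G ` arcs G"
      using that by (simp add: arcs_ends_def)
    then have "arc_at (u, v) \<in> arcs G" "arc_to_ends G (arc_at (u, v)) = (u, v)"
      unfolding arc_at_def using inj_on_arc_to_ends
      by (auto intro: the_inv_into_into simp: f_the_inv_into_f)
    then show ?thesis by (simp add: arc_to_ends_def)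
  qed
  have arc_at_ends: "arc_at (tail G e, head G e) = e" if "e \<in> arcs G" for e
    using the_inv_into_f_f[OF inj_on_arc_to_ends that] by (simp add: arc_at_def arc_to_ends_def)
  have f_adj: "f u \<rightarrow>\<^bsub>G\<^esub> f v" if "(u, v) \<in> parcs P" for u v
    using that adj P.in_arcsD1 P.in_arcsD2 by blast
  define h where "h = \<lparr>iso_verts = f, iso_arcs = (\<lambda>(u, v). arc_at (f u, f v)),
    iso_head = head G, iso_tail = tail G\<rparr>"
  have inj_arcs: "inj_on (\<lambda>(u, v). arc_at (f u, f v)) (parcs P)"
  proof (rule inj_onI, clarify)
    fix u v u' v'
    assume p: "(u, v) \<in> parcs P" "(u', v') \<in> parcs P"
      and eq: "arc_at (f u, f v) = arc_at (f u', f v')"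
    have "f u = f u'" "f v = f v'"
      using arc_at[OF f_adj[OF p(1)]] arc_at[OF f_adj[OF p(2)]] eq by metis+
    then show "u = u' \<and> v = v'"
      using inj_onD[OF inj] p[THEN P.in_arcsD1] p[THEN P.in_arcsD2] by blast
  qed
  have "pre_digraph.digraph_isomorphism (with_proj P) h"
    unfolding pre_digraph.digraph_isomorphism_def
    using P.wf_digraph inj inj_arcs arc_at f_adj by (auto simp: h_def)
  moreover have "G \<restriction> f ` pverts P = app_iso h (with_proj P)"
  proof -
    have "{e \<in> arcs G. tail G e \<in> f ` pverts P \<and> head G e \<in> f ` pverts P}
        = (\<lambda>(u, v). arc_at (f u, f v)) ` parcs P" (is "?L = ?R")
    proof
      show "?L \<subseteq> ?R"
      proof clarify
        fix e u v
        assume e: "e \<in> arcs G" and u: "tail G e = f u" "u \<in> pverts P"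
          and v: "head G e = f v" "v \<in> pverts P"
        have "f u \<rightarrow>\<^bsub>G\<^esub> f v"
          using e u v by (auto intro: dominatesI simp: arc_to_ends_def)
        then have "(u, v) \<in> parcs P" using adj u v by blast
        moreover have "e = arc_at (f u, f v)" using arc_at_ends[OF e] u v by simp
        ultimately show "e \<in> ?R" by force
      qed
      show "?R \<subseteq> ?L"
        using arc_at f_adj P.in_arcsD1 P.in_arcsD2 by auto
    qed
    then show ?thesis by (simp add: induce_subgraph_def app_iso_def h_def)
  qed
  ultimately show ?thesis unfolding digraph_iso_def by blast
qed

lemma (in graph) graph_induce_subgraph:
  assumes "finite V"
  shows "graph (G \<restriction> V)"
proof -
  have "symmetric (G \<restriction> V)"
    using sym_arcs unfolding symmetric_conv by fastforce
  then show ?thesis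
    using assms no_multi_arcs no_loops by unfold_locales (auto simp: arc_to_ends_def)
qed

text \<open>The simple graphs without an induced \<open>P\<^sub>6\<close>, dart or \<open>K\<^sub>4\<close>. The next lemmas turn each
  exclusion, stated by isomorphism, into one about adjacency of named vertices.\<close>

locale P6_dart_K4_free_graph = graph +
  assumes free: "P6_dart_K4_free G"
begin

lemma adj_sym: "u \<rightarrow>\<^bsub>G\<^esub> v \<Longrightarrow> v \<rightarrow>\<^bsub>G\<^esub> u"
  by (rule graph_symmetric)

lemma not_adj_sym: "\<not> u \<rightarrow>\<^bsub>G\<^esub> v \<Longrightarrow> \<not> v \<rightarrow>\<^bsub>G\<^esub> u"
  using adj_sym by blast

lemma adj_neq: "u \<rightarrow>\<^bsub>G\<^esub> v \<Longrightarrow> u \<noteq> v"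
  using adj_not_same by blast

lemma not_adj_self [simp]: "\<not> u \<rightarrow>\<^bsub>G\<^esub> u"
  using adj_not_same by blast

lemma no_K4:
  assumes "a \<rightarrow>\<^bsub>G\<^esub> b" "a \<rightarrow>\<^bsub>G\<^esub> c" "a \<rightarrow>\<^bsub>G\<^esub> d" "b \<rightarrow>\<^bsub>G\<^esub> c" "b \<rightarrow>\<^bsub>G\<^esub> d" "c \<rightarrow>\<^bsub>G\<^esub> d"
  shows False
proof -
  define V where "V = {a, b, c, d}"
  have sub: "induced_subgraph (G \<restriction> V) G"
    using assms adj_in_verts unfolding V_def by (intro induced_induce) blast
  have "graph (G \<restriction> V)"
    by (rule graph_induce_subgraph) (simp add: V_def)
  moreover have "card V = 4"
    using assms[THEN adj_neq] by (simp add: V_def)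
  moreover have "arcs_ends (G \<restriction> V) = {(u, v). (u, v) \<in> V \<times> V \<and> u \<noteq> v}"
  proof -
    have ends: "arcs_ends (G \<restriction> V) = {(u, v). u \<rightarrow>\<^bsub>G\<^esub> v \<and> u \<in> V \<and> v \<in> V}"
      by (auto simp: arcs_ends_conv)
    have "u \<rightarrow>\<^bsub>G\<^esub> v \<longleftrightarrow> u \<noteq> v" if "u \<in> V" "v \<in> V" for u v
      using that assms assms[THEN adj_sym] unfolding V_def by auto
    then show ?thesis unfolding ends by blast
  qed
  ultimately have "complete_digraph 4 (G \<restriction> V)"
    by (simp add: complete_digraph_def)
  then show False
    using free sub unfolding P6_dart_K4_free_def by blast
qed

text \<open>Only \<open>b \<noteq> d\<close> is needed besides the adjacencies; any other two of the five vertices are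
  adjacent or distinguished by a third one.\<close>

lemma no_dart:
  assumes "a \<rightarrow>\<^bsub>G\<^esub> b" "b \<rightarrow>\<^bsub>G\<^esub> c" "c \<rightarrow>\<^bsub>G\<^esub> d" "d \<rightarrow>\<^bsub>G\<^esub> a" "a \<rightarrow>\<^bsub>G\<^esub> c" "a \<rightarrow>\<^bsub>G\<^esub> e"
    and "b \<noteq> d" "\<not> b \<rightarrow>\<^bsub>G\<^esub> d" "\<not> b \<rightarrow>\<^bsub>G\<^esub> e" "\<not> c \<rightarrow>\<^bsub>G\<^esub> e" "\<not> d \<rightarrow>\<^bsub>G\<^esub> e"
  shows False
proof -
  define f where "f i = [a, b, c, d, e] ! (i - 1)" for i :: nat
  have V: "pverts dart_graph = {1, 2, 3, 4, 5}" by (simp add: dart_graph_def)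
  have f: "f 1 = a" "f (Suc 0) = a" "f 2 = b" "f 3 = c" "f 4 = d" "f 5 = e"
    by (simp_all add: f_def numeral_eq_Suc)
  have dist: "distinct [a, b, c, d, e]"
    using assms assms(1-6)[THEN adj_sym] by auto
  have "digraph_iso (with_proj dart_graph) (G \<restriction> f ` pverts dart_graph)"
  proof (rule digraph_iso_induce_subgraphI)
    show "pair_wf_digraph dart_graph"
      by unfold_locales (auto simp: dart_graph_def symcl_def)
    show "inj_on f (pverts dart_graph)"
      using dist unfolding V by (auto simp: f)
    show "f u \<rightarrow>\<^bsub>G\<^esub> f v \<longleftrightarrow> (u, v) \<in> parcs dart_graph"
      if "u \<in> pverts dart_graph" "v \<in> pverts dart_graph" for u v
      using that assms(1-6) assms(1-6)[THEN adj_sym] assms(8-11) assms(8-11)[THEN not_adj_sym]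
      unfolding V by (elim insertE emptyE; simp add: f dart_graph_def symcl_def)
  qed
  moreover have "induced_subgraph (G \<restriction> f ` pverts dart_graph) G"
    using assms adj_in_verts unfolding V by (intro induced_induce) (auto simp: f)
  ultimately show False
    using free unfolding P6_dart_K4_free_def by blast
qed

text \<open>The six vertices need not be assumed distinct: that follows from the adjacencies and
  non-adjacencies.\<close>

lemma no_P6:
  assumes "a \<rightarrow>\<^bsub>G\<^esub> b" "b \<rightarrow>\<^bsub>G\<^esub> c" "c \<rightarrow>\<^bsub>G\<^esub> d" "d \<rightarrow>\<^bsub>G\<^esub> e" "e \<rightarrow>\<^bsub>G\<^esub> g"
    and "\<not> a \<rightarrow>\<^bsub>G\<^esub> c" "\<not> a \<rightarrow>\<^bsub>G\<^esub> d" "\<not> a \<rightarrow>\<^bsub>G\<^esub> e" "\<not> a \<rightarrow>\<^bsub>G\<^esub> g" "\<not> b \<rightarrow>\<^bsub>G\<^esub> d" "\<not> b \<rightarrow>\<^bsub>G\<^esub> e" "\<not> b \<rightarrow>\<^bsub>G\<^esub> g"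
      "\<not> c \<rightarrow>\<^bsub>G\<^esub> e" "\<not> c \<rightarrow>\<^bsub>G\<^esub> g" "\<not> d \<rightarrow>\<^bsub>G\<^esub> g"
  shows False
proof -
  define f where "f i = [a, b, c, d, e, g] ! i" for i :: nat
  have V: "pverts (path_graph 6) = {0, 1, 2, 3, 4, 5}" by (auto simp: path_graph_def)
  have f: "f 0 = a" "f (Suc 0) = b" "f 1 = b" "f 2 = c" "f 3 = d" "f 4 = e" "f 5 = g"
    by (simp_all add: f_def numeral_eq_Suc)
  have dist: "distinct [a, b, c, d, e, g]"
    using assms assms(1-5)[THEN adj_sym] by auto
  have "digraph_iso (with_proj (path_graph 6)) (G \<restriction> f ` pverts (path_graph 6))"
  proof (rule digraph_iso_induce_subgraphI)
    show "pair_wf_digraph (path_graph 6)"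
      by unfold_locales (auto simp: path_graph_def symcl_def)
    show "inj_on f (pverts (path_graph 6))"
      using dist unfolding V by (auto simp: f)
    show "f u \<rightarrow>\<^bsub>G\<^esub> f v \<longleftrightarrow> (u, v) \<in> parcs (path_graph 6)"
      if "u \<in> pverts (path_graph 6)" "v \<in> pverts (path_graph 6)" for u v
    proof -
      have "(u, v) \<in> parcs (path_graph 6) \<longleftrightarrow> v = Suc u \<and> v < 6 \<or> u = Suc v \<and> u < 6" for u v
        by (auto simp: path_graph_def symcl_def image_iff)
      then show ?thesis
        using that assms assms(1-5)[THEN adj_sym] assms(6-15)[THEN not_adj_sym]
        unfolding V by (elim insertE emptyE; simp add: f)
    qed
  qed
  moreover have "induced_subgraph (G \<restriction> f ` pverts (path_graph 6)) G"
    using assms adj_in_verts unfolding V by (intro induced_induce) (auto simp: f)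
  ultimately show False
    using free unfolding P6_dart_K4_free_def by blast
qed

section \<open>Adjacencies between the components and the vertices they are complete to\<close>

text \<open>If a vertex \<open>q\<close> extended the edge \<open>xy\<close> of the triangle \<open>uxy\<close> to a diamond, a vertex of the
  triangle \<open>yrr'\<close> would complete it to a dart.\<close>

lemma triangle_extension_nonadjacent:
  assumes "u \<rightarrow>\<^bsub>G\<^esub> x" "u \<rightarrow>\<^bsub>G\<^esub> y" "x \<rightarrow>\<^bsub>G\<^esub> y" "q \<rightarrow>\<^bsub>G\<^esub> x"
    and "r \<rightarrow>\<^bsub>G\<^esub> y" "r' \<rightarrow>\<^bsub>G\<^esub> y" "r \<rightarrow>\<^bsub>G\<^esub> r'"
    and "u \<noteq> q" "\<not> u \<rightarrow>\<^bsub>G\<^esub> q" "\<not> u \<rightarrow>\<^bsub>G\<^esub> r" "\<not> u \<rightarrow>\<^bsub>G\<^esub> r'" "\<not> q \<rightarrow>\<^bsub>G\<^esub> r" "\<not> q \<rightarrow>\<^bsub>G\<^esub> r'"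
  shows "\<not> q \<rightarrow>\<^bsub>G\<^esub> y"
proof
  assume "q \<rightarrow>\<^bsub>G\<^esub> y"
  have dart: "p \<rightarrow>\<^bsub>G\<^esub> x" if "p \<rightarrow>\<^bsub>G\<^esub> y" "\<not> u \<rightarrow>\<^bsub>G\<^esub> p" "\<not> q \<rightarrow>\<^bsub>G\<^esub> p" for p
    using no_dart[of y u x q p] that assms \<open>q \<rightarrow>\<^bsub>G\<^esub> y\<close> adj_sym by metis
  have "r \<rightarrow>\<^bsub>G\<^esub> x" "r' \<rightarrow>\<^bsub>G\<^esub> x"
    using dart assms by blast+
  then show False
    using no_K4[of r r' x y] assms by blast
qed

text \<open>The configuration of the theorem, for one neighbour \<open>b\<close> of \<open>q\<close>; of the diamond,
  only the path \<open>u4, u1, b\<close> leaving it and the neighbour \<open>u2\<close> of \<open>z\<close> matter.\<close>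

lemma no_linked_triangles:
  assumes "u4 \<rightarrow>\<^bsub>G\<^esub> u1" "u1 \<rightarrow>\<^bsub>G\<^esub> b" "b \<rightarrow>\<^bsub>G\<^esub> q" "x \<rightarrow>\<^bsub>G\<^esub> y" "u2 \<rightarrow>\<^bsub>G\<^esub> z"
    and Q: "q \<rightarrow>\<^bsub>G\<^esub> q'" "q \<rightarrow>\<^bsub>G\<^esub> x" "q' \<rightarrow>\<^bsub>G\<^esub> x" "q \<rightarrow>\<^bsub>G\<^esub> z" "q' \<rightarrow>\<^bsub>G\<^esub> z"
    and R: "r \<rightarrow>\<^bsub>G\<^esub> r'" "r \<rightarrow>\<^bsub>G\<^esub> y" "r' \<rightarrow>\<^bsub>G\<^esub> y" "r \<rightarrow>\<^bsub>G\<^esub> z" "r' \<rightarrow>\<^bsub>G\<^esub> z"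
    and QR: "\<not> q \<rightarrow>\<^bsub>G\<^esub> r" "\<not> q \<rightarrow>\<^bsub>G\<^esub> r'" "\<not> q' \<rightarrow>\<^bsub>G\<^esub> r" "\<not> q \<rightarrow>\<^bsub>G\<^esub> y"
    and u4: "\<And>v. v \<in> {b, q, q', r, r', x, y, z} \<Longrightarrow> \<not> u4 \<rightarrow>\<^bsub>G\<^esub> v"
    and u1: "\<And>v. v \<in> {q, q', r, r', x, y, z} \<Longrightarrow> \<not> u1 \<rightarrow>\<^bsub>G\<^esub> v"
    and u2: "\<And>v. v \<in> {b, q, q'} \<Longrightarrow> \<not> u2 \<rightarrow>\<^bsub>G\<^esub> v"
  shows False
proof -
  note adj = assms(1-5) Q R assms(1-5)[THEN adj_sym] Q[THEN adj_sym] R[THEN adj_sym]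
  note nonadj = QR QR[THEN not_adj_sym] u4 u1 u2[THEN not_adj_sym]
  have b_z: "\<not> b \<rightarrow>\<^bsub>G\<^esub> z"
  proof
    assume bz: "b \<rightarrow>\<^bsub>G\<^esub> z"
    then have bq': "\<not> b \<rightarrow>\<^bsub>G\<^esub> q'"
      using no_K4[of b z q q'] adj by blast
    moreover have "b \<noteq> q'"
      using assms(2) u1[of q'] by auto
    ultimately show False
      using bz bz[THEN adj_sym] adj nonadj by (intro no_dart[of z b q q' u2]) simp_all
  qed
  have "b \<rightarrow>\<^bsub>G\<^esub> r"
    using no_P6[of u4 u1 b q z r] b_z adj nonadj by auto
  have "b \<rightarrow>\<^bsub>G\<^esub> r'"
    using no_P6[of u4 u1 b q z r'] b_z adj nonadj by auto
  have "b \<rightarrow>\<^bsub>G\<^esub> q'"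
    using no_P6[of u4 u1 b r z q'] \<open>b \<rightarrow>\<^bsub>G\<^esub> r\<close> b_z adj nonadj by auto
  then have "\<not> b \<rightarrow>\<^bsub>G\<^esub> x"
    using no_K4[of b q q' x] adj by blast
  moreover have "\<not> b \<rightarrow>\<^bsub>G\<^esub> y"
    using no_K4[of b r r' y] \<open>b \<rightarrow>\<^bsub>G\<^esub> r\<close> \<open>b \<rightarrow>\<^bsub>G\<^esub> r'\<close> adj by blast
  ultimately show False
    using no_P6[of u4 u1 b q x y] adj nonadj by auto
qed

end

section \<open>Components of induced subgraphs and the theorem\<close>

lemma adj_in_same_component:
  assumes "graph G"
    and S: "S \<in> pre_digraph.sccs_verts (G \<restriction> V)" and T: "T \<in> pre_digraph.sccs_verts (G \<restriction> V)"
    and "s \<in> S" "t \<in> T" "s \<in> V" "t \<in> V" "s \<rightarrow>\<^bsub>G\<^esub> t"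
  shows "S = T"
proof -
  interpret G: graph G by fact
  interpret V: wf_digraph "G \<restriction> V" by unfold_locales auto
  have adj: "u \<rightarrow>\<^bsub>G \<restriction> V\<^esub> v" if "u \<rightarrow>\<^bsub>G\<^esub> v" "u \<in> V" "v \<in> V" for u v
    using that by (fastforce simp: arcs_ends_conv)
  have "s \<rightarrow>\<^sup>*\<^bsub>G \<restriction> V\<^esub> t" "t \<rightarrow>\<^sup>*\<^bsub>G \<restriction> V\<^esub> s"
    using assms adj G.graph_symmetric V.reachable_adjI by blast+
  then have "t \<in> S"
    using S \<open>s \<in> S\<close> unfolding V.in_sccs_verts_conv_reachable by blast
  then show ?thesis
    using V.sccs_verts_disjoint[OF S T] \<open>t \<in> T\<close> by blast
qed

lemma component_subset:
  assumes "graph G" and "S \<in> pre_digraph.sccs_verts (G \<restriction> V)"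
  shows "S \<subseteq> V"
proof -
  interpret G: graph G by fact
  interpret V: wf_digraph "G \<restriction> V" by unfold_locales auto
  show ?thesis using V.sccs_verts_subsets[OF assms(2)] by simp
qed

theorem lemma2p5:
  fixes G H :: "('a, 'b) pre_digraph"
    and u1 u2 u3 u4 :: 'a
    and A2 B13 C2 C4 Z Z1 :: "'a set"
  assumes "Digraph.graph G"
    and "Digraph_Component.connected G"
    and "P6_dart_K4_free G"
    and "\<nexists>K. clique_cutset G K"
    and "induced_subgraph H G"
    and "distinct [u1, u2, u3, u4]"
    and "verts H = {u1, u2, u3, u4}"
    and "arcs_ends H = symcl {(u1, u2), (u2, u3), (u3, u4), (u4, u1), (u1, u3)}"
    and "A2 = attached G H {u2}"
    and "B13 = attached G H {u1, u3}"
    and "C2 = attached G H {u2, u3, u4}"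
    and "C4 = attached G H {u4, u1, u2}"
    and "Z = attached G H {}"
    and "Z1 = \<Union> {Q \<in> pre_digraph.sccs_verts (G \<restriction> Z). \<exists>v\<in>Q. has_nbr_in G v A2}"
    and "C2 = {}" and "C4 = {}" and "B13 \<noteq> {}"
  shows "\<not> (\<exists>x\<in>A2. \<exists>y\<in>A2. \<exists>z\<in>A2. \<exists>q q' r r'.
           bad_component G Z1 B13 q q' \<and> bad_component G Z1 B13 r r' \<and>
           x \<rightarrow>\<^bsub>G\<^esub> y \<and> complete_to G {q, q'} {x, z} \<and> complete_to G {r, r'} {z, y})"
proof
  interpret P6_dart_K4_free_graph G
    using assms by (simp add: P6_dart_K4_free_graph_def P6_dart_K4_free_graph_axioms_def)
  assume "\<exists>x\<in>A2. \<exists>y\<in>A2. \<exists>z\<in>A2. \<exists>q q' r r'.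
           bad_component G Z1 B13 q q' \<and> bad_component G Z1 B13 r r' \<and>
           x \<rightarrow>\<^bsub>G\<^esub> y \<and> complete_to G {q, q'} {x, z} \<and> complete_to G {r, r'} {z, y}"
  then obtain x y z q q' r r' where A2: "x \<in> A2" "y \<in> A2" "z \<in> A2"
    and bad: "bad_component G Z1 B13 q q'" "bad_component G Z1 B13 r r'"
    and xy: "x \<rightarrow>\<^bsub>G\<^esub> y"
    and complete: "complete_to G {q, q'} {x, z}" "complete_to G {r, r'} {z, y}"
    by blast
  have Q: "q \<rightarrow>\<^bsub>G\<^esub> q'" "q \<rightarrow>\<^bsub>G\<^esub> x" "q' \<rightarrow>\<^bsub>G\<^esub> x" "q \<rightarrow>\<^bsub>G\<^esub> z" "q' \<rightarrow>\<^bsub>G\<^esub> z"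
    and R: "r \<rightarrow>\<^bsub>G\<^esub> r'" "r \<rightarrow>\<^bsub>G\<^esub> y" "r' \<rightarrow>\<^bsub>G\<^esub> y" "r \<rightarrow>\<^bsub>G\<^esub> z" "r' \<rightarrow>\<^bsub>G\<^esub> z"
    and comp: "{q, q'} \<in> pre_digraph.sccs_verts (G \<restriction> Z1)"
      "{r, r'} \<in> pre_digraph.sccs_verts (G \<restriction> Z1)"
    using bad complete by (auto simp: bad_component_def complete_to_def)
  obtain b where b: "b \<in> B13" "q \<rightarrow>\<^bsub>G\<^esub> b"
    using bad by (auto simp: bad_component_def has_nbr_in_def)
  have Z1: "{q, q', r, r'} \<subseteq> Z1"
    using comp[THEN component_subset[OF assms(1)]] by simp
  also have "Z1 \<subseteq> Z"
    using component_subset[OF assms(1)] unfolding assms(14) by blast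
  finally have Z: "q \<in> Z" "q' \<in> Z" "r \<in> Z" "r' \<in> Z" by auto
  have nbr: "u \<rightarrow>\<^bsub>G\<^esub> v \<longleftrightarrow> u \<in> T" if "v \<in> attached G H T" "u \<in> {u1, u2, u3, u4}" for u v T
    using that assms(7) adj_sym by (auto simp: attached_def nbrs_in_def)
  have A2_nbr: "u \<rightarrow>\<^bsub>G\<^esub> v \<longleftrightarrow> u = u2" if "v \<in> A2" "u \<in> {u1, u2, u3, u4}" for u v
    using nbr that assms(9) by auto
  have B13_nbr: "u \<rightarrow>\<^bsub>G\<^esub> v \<longleftrightarrow> u = u1 \<or> u = u3" if "v \<in> B13" "u \<in> {u1, u2, u3, u4}" for u v
    using nbr that assms(10) by auto
  have Z_nbr: "\<not> u \<rightarrow>\<^bsub>G\<^esub> v" if "v \<in> Z" "u \<in> {u1, u2, u3, u4}" for u v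
    using nbr that assms(13) by auto
  have u2_notin: "u2 \<notin> Z"
    using assms(7,13) by (auto simp: attached_def)
  have u4_u1: "u4 \<rightarrow>\<^bsub>G\<^esub> u1"
  proof -
    have "u4 \<rightarrow>\<^bsub>H\<^esub> u1" using assms(8) by (simp add: symcl_def)
    then show ?thesis using assms(5) adj_mono unfolding induced_subgraph_def by blast
  qed
  have "{q, q'} \<noteq> {r, r'}"
  proof
    assume "{q, q'} = {r, r'}"
    then have "q \<rightarrow>\<^bsub>G\<^esub> y" "q' \<rightarrow>\<^bsub>G\<^esub> y" using R by (auto simp: doubleton_eq_iff)
    then show False using no_K4[of q q' x y] Q xy by blast
  qed
  then have QR: "\<not> s \<rightarrow>\<^bsub>G\<^esub> t" if "s \<in> {q, q'}" "t \<in> {r, r'}" for s t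
    using adj_in_same_component[OF assms(1) comp] that Z1 by blast
  have q_y: "\<not> q \<rightarrow>\<^bsub>G\<^esub> y"
  proof (rule triangle_extension_nonadjacent[of u2 x y q r r'])
    show "u2 \<noteq> q" using u2_notin Z by blast
  qed (use A2_nbr[OF A2(1), of u2] A2_nbr[OF A2(2), of u2] Z_nbr[of _ u2] Z
      QR[of q r] QR[of q r'] Q R xy in simp_all)
  show False
  proof (rule no_linked_triangles[of u4 u1 b q x y u2 z q' r r'])
    show "\<not> u4 \<rightarrow>\<^bsub>G\<^esub> v" if "v \<in> {b, q, q', r, r', x, y, z}" for v
      using that A2_nbr[of _ u4] A2 B13_nbr[OF b(1)] Z_nbr[of _ u4] Z assms(6) by auto
    show "\<not> u1 \<rightarrow>\<^bsub>G\<^esub> v" if "v \<in> {q, q', r, r', x, y, z}" for v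
      using that A2_nbr[of _ u1] A2 Z_nbr[of _ u1] Z assms(6) by auto
    show "\<not> u2 \<rightarrow>\<^bsub>G\<^esub> v" if "v \<in> {b, q, q'}" for v
      using that B13_nbr[OF b(1)] Z_nbr[of _ u2] Z assms(6) by auto
    show "u1 \<rightarrow>\<^bsub>G\<^esub> b" "u2 \<rightarrow>\<^bsub>G\<^esub> z"
      using B13_nbr[OF b(1)] A2_nbr[OF A2(3)] by simp_all
  qed (use q_y u4_u1 adj_sym[OF b(2)] xy Q R QR[of q r] QR[of q r'] QR[of q' r] in simp_all)
qed

end
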